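(* Let $G$ be a finite group. Then \[ssd(G) < \frac{|G|^2}{|\mathcal{L}(G)|^2} \sum_{H,K \in \mathcal{L}(G)} d(H,K),\] where the sum runs over all ordered pairs $(H,K)$ of subgroups of $G$.
   Context: For a finite group $G$, $\mathcal{L}(G)$ denotes the set (lattice) of all subgroups of $G$. For subgroups $H,K$ of $G$, $[H,K]=\langle [h,k] \mid h\in H, k\in K\rangle$. The strong subgroup commutativity degree of $G$ is \[ssd(G)=\frac{|\{(H,K)\in\mathcal{L}(G)^2 \mid [H,K]=1\}|}{|\mathcal{L}(G)|^2}.\] For subgroups $H,K$ of $G$, \[d(H,K)=\frac{|\{(h,k)\in H\times K\mid [h,k]=1\}|}{|H||K|}.\]
   Formalization: The finite group G is assumed to be non-trivial; for the trivial group both sides equal 1, so the strict inequality as stated is false there. *)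

theory Defs
  imports Complex_Main "HOL-Algebra.Generated_Groups"
begin

definition subgroup_lattice :: "('a, 'b) monoid_scheme \<Rightarrow> 'a set set" where
  "subgroup_lattice G = {H. subgroup H G}"

text \<open>
  The convention for $[h,k]$ is that of the library's \<^const>\<open>derived\<close>, i.e. $h k h^{-1} k^{-1}$.
\<close>
definition commutator :: "('a, 'b) monoid_scheme \<Rightarrow> 'a \<Rightarrow> 'a \<Rightarrow> 'a" where
  "commutator G h k = h \<otimes>\<^bsub>G\<^esub> k \<otimes>\<^bsub>G\<^esub> inv\<^bsub>G\<^esub> h \<otimes>\<^bsub>G\<^esub> inv\<^bsub>G\<^esub> k"

definition commutator_subgroup :: "('a, 'b) monoid_scheme \<Rightarrow> 'a set \<Rightarrow> 'a set \<Rightarrow> 'a set" where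
  "commutator_subgroup G H K = generate G {commutator G h k | h k. h \<in> H \<and> k \<in> K}"

definition ssd :: "('a, 'b) monoid_scheme \<Rightarrow> real" where
  "ssd G =
     real (card {(H, K) \<in> subgroup_lattice G \<times> subgroup_lattice G.
                   commutator_subgroup G H K = {\<one>\<^bsub>G\<^esub>}})
     / (real (card (subgroup_lattice G)))\<^sup>2"

definition commutativity_degree :: "('a, 'b) monoid_scheme \<Rightarrow> 'a set \<Rightarrow> 'a set \<Rightarrow> real" where
  "commutativity_degree G H K =
     real (card {(h, k) \<in> H \<times> K. commutator G h k = \<one>\<^bsub>G\<^esub>}) / (real (card H) * real (card K))"

end

theory Submission
  imports Defs
begin

text \<open>
  If $[H,K]=1$ then $d(H,K)=1$, and $d \ge 0$ always, so the number of commuting pairs is at most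
  $\sum d(H,K)$. This sum is positive because of the pair of trivial subgroups, and $|G|^2 > 1$.
\<close>

lemma commutativity_degree_nonneg: "commutativity_degree G H K \<ge> 0"
  by (simp add: commutativity_degree_def)

lemma (in group) commutativity_degree_eq_1:
  assumes "finite (carrier G)" "subgroup H G" "subgroup K G"
    and "commutator_subgroup G H K = {\<one>}"
  shows "commutativity_degree G H K = 1"
proof -
  have "commutator G h k = \<one>" if "h \<in> H" "k \<in> K" for h k
  proof -
    have "commutator G h k \<in> commutator_subgroup G H K"
      unfolding commutator_subgroup_def using that by (blast intro: generate.incl)
    with assms(4) show ?thesis by simp
  qed
  then have "{(h, k) \<in> H \<times> K. commutator G h k = \<one>} = H \<times> K"
    by auto
  \<comment> \<open>Division by zero yields 0 in HOL, so the quotient equals 1 only because both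
    cardinalities are nonzero.\<close>
  moreover have "card H > 0" "card K > 0"
    using assms(1-3) by (simp_all add: subgroup.finite_imp_card_positive)
  ultimately show ?thesis
    by (simp add: commutativity_degree_def card_cartesian_product)
qed

lemma (in group) commutator_subgroup_one:
  "commutator_subgroup G {\<one>} {\<one>} = {\<one>}"
  by (simp add: commutator_subgroup_def commutator_def generate_one)

lemma (in group) finite_subgroup_lattice:
  "finite (carrier G) \<Longrightarrow> finite (subgroup_lattice G)"
  unfolding subgroup_lattice_def
  by (rule finite_subset[of _ "Pow (carrier G)"]) (auto dest: subgroup.subset)

text \<open>For the trivial group both sides equal 1, so the strict inequality fails there;
  \<open>nontrivial\<close> excludes exactly this case.\<close>

theorem theorem2p2:
  fixes G :: "('a, 'b) monoid_scheme" (structure)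
  assumes "group G"
    and "finite (carrier G)"
    and nontrivial: "carrier G \<noteq> {\<one>}"
  shows "ssd G
    < (real (order G))\<^sup>2 / (real (card (subgroup_lattice G)))\<^sup>2
      * (\<Sum>(H, K) \<in> subgroup_lattice G \<times> subgroup_lattice G. commutativity_degree G H K)"
proof -
  interpret group G by fact
  let ?L = "subgroup_lattice G"
  let ?C = "{(H, K) \<in> ?L \<times> ?L. commutator_subgroup G H K = {\<one>}}"
  let ?S = "\<Sum>(H, K) \<in> ?L \<times> ?L. commutativity_degree G H K"
  have finL: "finite ?L"
    using assms(2) by (rule finite_subgroup_lattice)
  have one_in_L: "{\<one>} \<in> ?L"
    by (simp add: subgroup_lattice_def triv_subgroup)
  have finC: "finite ?C"
    by (rule finite_subset[of _ "?L \<times> ?L"]) (use finL in auto)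
  have "({\<one>}, {\<one>}) \<in> ?C"
    using one_in_L commutator_subgroup_one by simp
  with finC have C_pos: "0 < real (card ?C)"
    using card_gt_0_iff by fastforce
  \<comment> \<open>Every summand over \<open>?C\<close> is 1, so the sum counts the pairs in
    \<open>?C\<close>.\<close>
  have "real (card ?C) = (\<Sum>(H, K) \<in> ?C. commutativity_degree G H K)"
    using commutativity_degree_eq_1[OF assms(2)]
    by (subst sum.cong[where h = "\<lambda>_. 1" and B = ?C]) (auto simp: subgroup_lattice_def)
  also have "\<dots> \<le> ?S"
    by (rule sum_mono2) (use finL commutativity_degree_nonneg in auto)
  finally have C_le: "real (card ?C) \<le> ?S" .
  have "card {\<one>} < order G"
    unfolding order_def using assms(2) nontrivial by (intro psubset_card_mono) auto
  then have "1 < (real (order G))\<^sup>2"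
    by (simp add: one_less_power)
  \<comment> \<open>Strictness enters here: \<open>?S\<close> is positive, being at least
    \<open>card ?C\<close>, so a factor above 1 strictly enlarges it and \<open>card ?C\<close>
    \<le> \<open>?S\<close> < |G|^2 * \<open>?S\<close>.\<close>
  with C_pos C_le have "real (card ?C) < (real (order G))\<^sup>2 * ?S"
    by (smt (verit) mult_less_cancel_right1)
  \<comment> \<open>Both sides of the claim have this denominator; its positivity keeps the
    inequality strict after division.\<close>
  moreover have "0 < (real (card ?L))\<^sup>2"
    using finL one_in_L card_gt_0_iff by fastforce
  ultimately show ?thesis
    unfolding ssd_def by (simp add: divide_strict_right_mono)
qed

end
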